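(* Let $\mathbb{F}$ be a field of characteristic $0$. The vector product $\vec{\ltimes}:\mathcal{M}\times\mathcal{V}\to\mathcal{V}$ extends to a well-defined map $\vec{\ltimes}:\Sigma_{\mathcal{M}}\times\Omega_{\mathcal{V}}\to\Omega_{\mathcal{V}}$, $\langle A\rangle\,\vec{\ltimes}\,\lceil X\rceil:=\lceil A\,\vec{\ltimes}\,X\rceil$. In particular, each $\langle A\rangle\in\Sigma_{\mathcal{M}}$ determines a linear mapping on the vector space $\Omega_{\mathcal{V}}$.
   Context: $\mathcal{M}$ is the set of all finite-size matrices over $\mathbb{F}$ and $\mathcal{V}=\bigcup_{i\ge1}\mathcal{V}_i$, $\mathcal{V}_i=\mathbb{F}^i$, the set of all column vectors of all finite dimensions. $\otimes$ is the Kronecker product and $\mathbf{1}_s\in\mathbb{F}^s$ the all-ones vector. $A\sim B$ in $\mathcal{M}$ means $A\otimes I_s=B\otimes I_t$ for some positive integers $s,t$; $\Sigma_{\mathcal{M}}:=\mathcal{M}/\!\sim$ with classes $\langle A\rangle$. $X\leftrightarrow Y$ in $\mathcal{V}$ means $X\otimes\mathbf{1}_s=Y\otimes\mathbf{1}_t$ for some positive integers $s,t$; $\Omega_{\mathcal{V}}:=\mathcal{V}/\!\leftrightarrow$ with classes $\lceil X\rceil$. $\Omega_{\mathcal{V}}$ is a vector space under $a\lceil X\rceil:=\lceil aX\rceil$ and $\lceil X\rceil\,\vec{\boxplus}\,\lceil Y\rceil:=\lceil X\otimes\mathbf{1}_{t/p}+Y\otimes\mathbf{1}_{t/q}\rceil$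 for $X\in\mathcal{V}_p$, $Y\in\mathcal{V}_q$, $t=\mathrm{lcm}(p,q)$. For $A\in\mathcal{M}_{m\times n}$, $X\in\mathcal{V}_p$, $t=\mathrm{lcm}(n,p)$, the vector product is $A\,\vec{\ltimes}\,X:=(A\otimes I_{t/n})(X\otimes\mathbf{1}_{t/p})$. *)

theory Defs
  imports "Jordan_Normal_Form.Matrix"
begin

text \<open>
  Matrices and vectors of the library may have dimension 0; \<open>matrices\<close> and \<open>vectors\<close> exclude this.
  The products below divide by dimensions, and \<open>s div 0 = 0\<close> would give no sensible value there.
\<close>

definition matrices :: "'a mat set" where
  "matrices = {A. 0 < dim_row A \<and> 0 < dim_col A}"

definition vectors :: "'a vec set" where
  "vectors = {X. 0 < dim_vec X}"

definition kron :: "'a::field mat \<Rightarrow> 'a mat \<Rightarrow> 'a mat" (infixl \<open>\<otimes>\<^sub>m\<close> 70) where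
  "A \<otimes>\<^sub>m B = mat (dim_row A * dim_row B) (dim_col A * dim_col B)
     (\<lambda>(i, j). A $$ (i div dim_row B, j div dim_col B) * B $$ (i mod dim_row B, j mod dim_col B))"

text \<open>The Kronecker product of column vectors, as for matrices with a single column.\<close>

definition kron_vec :: "'a::field vec \<Rightarrow> 'a vec \<Rightarrow> 'a vec" (infixl \<open>\<otimes>\<^sub>v\<close> 70) where
  "X \<otimes>\<^sub>v Y = vec (dim_vec X * dim_vec Y) (\<lambda>i. X $ (i div dim_vec Y) * Y $ (i mod dim_vec Y))"

definition ones :: "nat \<Rightarrow> 'a::field vec" where
  "ones s = vec s (\<lambda>_. 1)"

definition mat_equiv :: "'a::field mat \<Rightarrow> 'a mat \<Rightarrow> bool" where
  "mat_equiv A B \<longleftrightarrow> A \<in> matrices \<and> B \<in> matrices \<and>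
     (\<exists>s t. 0 < s \<and> 0 < t \<and> A \<otimes>\<^sub>m 1\<^sub>m s = B \<otimes>\<^sub>m 1\<^sub>m t)"

definition vec_equiv :: "'a::field vec \<Rightarrow> 'a vec \<Rightarrow> bool" where
  "vec_equiv X Y \<longleftrightarrow> X \<in> vectors \<and> Y \<in> vectors \<and>
     (\<exists>s t. 0 < s \<and> 0 < t \<and> X \<otimes>\<^sub>v ones s = Y \<otimes>\<^sub>v ones t)"

definition vec_boxplus :: "'a::field vec \<Rightarrow> 'a vec \<Rightarrow> 'a vec" where
  "vec_boxplus X Y = (let t = lcm (dim_vec X) (dim_vec Y) in
     X \<otimes>\<^sub>v ones (t div dim_vec X) + Y \<otimes>\<^sub>v ones (t div dim_vec Y))"

definition vec_prod :: "'a::field mat \<Rightarrow> 'a vec \<Rightarrow> 'a vec" where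
  "vec_prod A X = (let t = lcm (dim_col A) (dim_vec X) in
     (A \<otimes>\<^sub>m 1\<^sub>m (t div dim_col A)) *\<^sub>v (X \<otimes>\<^sub>v ones (t div dim_vec X)))"


section \<open>The quotient by \<open>mat_equiv\<close>\<close>

lemma kron_kron_one:
  assumes "0 < s" "0 < u"
  shows "(A \<otimes>\<^sub>m 1\<^sub>m s) \<otimes>\<^sub>m 1\<^sub>m u = A \<otimes>\<^sub>m 1\<^sub>m (s * u)"
proof (rule eq_matI)
  fix i j
  assume "i < dim_row (A \<otimes>\<^sub>m 1\<^sub>m (s * u))" "j < dim_col (A \<otimes>\<^sub>m 1\<^sub>m (s * u))"
  then have i: "i < dim_row A * s * u" and j: "j < dim_col A * s * u"
    by (auto simp: kron_def mult.assoc)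
  have iu: "i div u < dim_row A * s" and ju: "j div u < dim_col A * s"
    using i j by (auto intro: less_mult_imp_div_less)
  have k: "k mod (s * u) < s * u" "k mod u < u" "k div u mod s < s" for k
    using assms by auto
  have m: "k mod (s * u) = u * (k div u mod s) + k mod u" for k
    by (metis mod_mult2_eq mult.commute)
  have eq: "i mod (s * u) = j mod (s * u) \<longleftrightarrow> i div u mod s = j div u mod s \<and> i mod u = j mod u"
  proof
    assume h: "i mod (s * u) = j mod (s * u)"
    have "k mod (s * u) div u = k div u mod s" "k mod (s * u) mod u = k mod u" for k
      using assms by (simp_all add: m)
    with h show "i div u mod s = j div u mod s \<and> i mod u = j mod u" by metis
  next
    assume "i div u mod s = j div u mod s \<and> i mod u = j mod u"
    then show "i mod (s * u) = j mod (s * u)" by (simp add: m)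
  qed
  have d: "k div (s * u) = k div u div s" for k
    by (metis div_mult2_eq mult.commute)
  show "((A \<otimes>\<^sub>m 1\<^sub>m s) \<otimes>\<^sub>m 1\<^sub>m u) $$ (i, j) = (A \<otimes>\<^sub>m 1\<^sub>m (s * u)) $$ (i, j)"
    using i j iu ju k eq by (simp add: kron_def d mult.assoc)
qed (simp_all add: kron_def)

lemma equivp_mat_equiv: "part_equivp (mat_equiv :: 'a::field mat \<Rightarrow> _)"
proof (rule part_equivpI)
  have "mat_equiv (1\<^sub>m 1 :: 'a mat) (1\<^sub>m 1)"
    by (auto simp: mat_equiv_def matrices_def)
  then show "\<exists>A :: 'a mat. mat_equiv A A" by blast
  show "symp (mat_equiv :: 'a mat \<Rightarrow> _)"
    unfolding symp_def mat_equiv_def by metis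
  show "transp (mat_equiv :: 'a mat \<Rightarrow> _)"
  proof (rule transpI)
    fix A B C :: "'a mat"
    assume "mat_equiv A B" "mat_equiv B C"
    then obtain s t u v where p: "0 < s" "0 < t" "0 < u" "0 < v"
      and e: "A \<otimes>\<^sub>m 1\<^sub>m s = B \<otimes>\<^sub>m 1\<^sub>m t" "B \<otimes>\<^sub>m 1\<^sub>m u = C \<otimes>\<^sub>m 1\<^sub>m v"
      and m: "A \<in> matrices" "C \<in> matrices"
      unfolding mat_equiv_def by blast
    have "A \<otimes>\<^sub>m 1\<^sub>m (s * u) = B \<otimes>\<^sub>m 1\<^sub>m (t * u)"
      using e(1) p kron_kron_one by metis
    also have "\<dots> = C \<otimes>\<^sub>m 1\<^sub>m (v * t)"
      using e(2) p kron_kron_one by (metis mult.commute)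
    finally show "mat_equiv A C"
      unfolding mat_equiv_def using p m by (metis nat_0_less_mult_iff)
  qed
qed

text \<open>
  The quotients are partial: the relations are reflexive exactly on \<open>matrices\<close> and \<open>vectors\<close>, and
  \<open>mat_class A\<close>, \<open>vec_class X\<close> are the classes of \<open>A \<in> matrices\<close>, \<open>X \<in> vectors\<close>
  (and unspecified otherwise).
\<close>

quotient_type (overloaded) 'a Sigma_M = "'a::field mat" / partial: mat_equiv
  morphisms rep_Sigma_M mat_class
  by (rule equivp_mat_equiv)

lemma mat_class_eq_iff:
  "A \<in> matrices \<Longrightarrow> B \<in> matrices \<Longrightarrow> mat_class A = mat_class B \<longleftrightarrow> mat_equiv A B"
  using Quotient3_rel[OF Quotient3_Sigma_M, of A B] by (auto simp: mat_equiv_def)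


section \<open>The quotient by \<open>vec_equiv\<close>\<close>

text \<open>
  A vector of dimension \<open>p\<close> yields a step function on \<open>[0, 1)\<close> with steps of length \<open>1 / p\<close>.
  Two vectors are equivalent iff they have the same step function.
\<close>

definition step_fun :: "'a::field vec \<Rightarrow> real \<Rightarrow> 'a" where
  "step_fun X r = (if 0 \<le> r \<and> r < 1 then X $ nat \<lfloor>r * real (dim_vec X)\<rfloor> else 0)"

lemma step_index_less:
  assumes "0 \<le> r" "r < 1" "0 < p"
  shows "nat \<lfloor>r * real p\<rfloor> < p"
proof -
  have "r * real p < real p" using assms by simp
  then have "\<lfloor>r * real p\<rfloor> < int p" by (simp add: floor_less_iff)
  then show ?thesis using assms by linarith
qed

lemma dim_kron_ones [simp]: "dim_vec (X \<otimes>\<^sub>v ones s) = dim_vec X * s"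
  by (simp add: kron_vec_def ones_def)

lemma kron_ones_in_vectors: "X \<in> vectors \<Longrightarrow> 0 < s \<Longrightarrow> X \<otimes>\<^sub>v ones s \<in> vectors"
  by (simp add: vectors_def)

lemma index_kron_ones: "i < dim_vec X * s \<Longrightarrow> (X \<otimes>\<^sub>v ones s) $ i = X $ (i div s)"
  by (cases "s = 0") (simp_all add: kron_vec_def ones_def)

lemma step_fun_kron_ones:
  assumes "X \<in> vectors" "0 < s"
  shows "step_fun (X \<otimes>\<^sub>v ones s) = step_fun X"
proof
  fix r :: real
  show "step_fun (X \<otimes>\<^sub>v ones s) r = step_fun X r"
  proof (cases "0 \<le> r \<and> r < 1")
    case True
    let ?p = "dim_vec X"
    have p: "0 < ?p" using assms by (simp add: vectors_def)
    have l: "nat \<lfloor>r * real (?p * s)\<rfloor> < ?p * s"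
      using True p assms by (intro step_index_less) auto
    have "\<lfloor>r * real ?p\<rfloor> = \<lfloor>r * real (?p * s) / real_of_int (int s)\<rfloor>"
      using assms by simp
    also have "\<dots> = \<lfloor>r * real (?p * s)\<rfloor> div int s"
      by (rule floor_divide_real_eq_div) simp
    finally have "nat \<lfloor>r * real ?p\<rfloor> = nat \<lfloor>r * real (?p * s)\<rfloor> div s"
      using True by (simp add: nat_div_distrib)
    then show ?thesis
      using True l by (simp add: step_fun_def index_kron_ones)
  qed (auto simp: step_fun_def)
qed

lemma step_fun_inject:
  assumes "dim_vec X = dim_vec Y" "step_fun X = step_fun Y"
  shows "X = Y"
proof (rule eq_vecI)
  fix i
  assume i: "i < dim_vec Y"
  let ?r = "real i / real (dim_vec Y)"
  have r: "?r * real (dim_vec Y) = real i" "0 \<le> ?r" "?r < 1" using i by auto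
  have "step_fun X ?r = step_fun Y ?r" using assms by simp
  then show "X $ i = Y $ i"
    using r(2,3) unfolding step_fun_def assms(1) r(1) by simp
qed (fact assms)

lemma vec_equiv_iff:
  "vec_equiv X Y \<longleftrightarrow> X \<in> vectors \<and> Y \<in> vectors \<and> step_fun X = step_fun Y"
proof
  assume "vec_equiv X Y"
  then show "X \<in> vectors \<and> Y \<in> vectors \<and> step_fun X = step_fun Y"
    unfolding vec_equiv_def using step_fun_kron_ones by metis
next
  assume h: "X \<in> vectors \<and> Y \<in> vectors \<and> step_fun X = step_fun Y"
  then have p: "0 < dim_vec X" "0 < dim_vec Y" by (auto simp: vectors_def)
  have "X \<otimes>\<^sub>v ones (dim_vec Y) = Y \<otimes>\<^sub>v ones (dim_vec X)"
    using h p by (intro step_fun_inject) (simp_all add: step_fun_kron_ones)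
  then show "vec_equiv X Y" unfolding vec_equiv_def using h p by blast
qed

lemma equivp_vec_equiv: "part_equivp (vec_equiv :: 'a::field vec \<Rightarrow> _)"
proof (rule part_equivpI)
  have "vec_equiv (0\<^sub>v 1 :: 'a vec) (0\<^sub>v 1)"
    by (auto simp: vec_equiv_iff vectors_def)
  then show "\<exists>X :: 'a vec. vec_equiv X X" by blast
qed (auto simp: symp_def transp_def vec_equiv_iff)

quotient_type (overloaded) 'a Omega_V = "'a::field vec" / partial: vec_equiv
  morphisms rep_Omega_V vec_class
  by (rule equivp_vec_equiv)

lemma vec_class_eq_iff:
  "X \<in> vectors \<Longrightarrow> Y \<in> vectors \<Longrightarrow> vec_class X = vec_class Y \<longleftrightarrow> vec_equiv X Y"
  using Quotient3_rel[OF Quotient3_Omega_V, of X Y] by (auto simp: vec_equiv_iff)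


section \<open>The vector space of classes of vectors\<close>

lemma boxplus_in_vectors: "X \<in> vectors \<Longrightarrow> Y \<in> vectors \<Longrightarrow> vec_boxplus X Y \<in> vectors"
  by (simp add: vectors_def vec_boxplus_def Let_def lcm_pos_nat)

lemma step_fun_add:
  assumes "X \<in> vectors" "dim_vec X = dim_vec Y"
  shows "step_fun (X + Y) r = step_fun X r + step_fun Y r"
  using assms step_index_less[of r "dim_vec Y"] by (auto simp: step_fun_def vectors_def)

lemma step_fun_boxplus:
  assumes "X \<in> vectors" "Y \<in> vectors"
  shows "step_fun (vec_boxplus X Y) r = step_fun X r + step_fun Y r"
proof -
  let ?t = "lcm (dim_vec X) (dim_vec Y)"
  have "0 < ?t" using assms by (simp add: vectors_def lcm_pos_nat)
  then have p: "0 < ?t div dim_vec X" "0 < ?t div dim_vec Y"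
    by (metis dvd_div_eq_0_iff dvd_lcm1 neq0_conv, metis dvd_div_eq_0_iff dvd_lcm2 neq0_conv)
  show ?thesis
    using assms p
    by (simp add: vec_boxplus_def Let_def step_fun_add step_fun_kron_ones kron_ones_in_vectors)
qed

lemma step_fun_smult:
  assumes "X \<in> vectors"
  shows "step_fun (c \<cdot>\<^sub>v X) r = c * step_fun X r"
  using assms step_index_less[of r "dim_vec X"] by (auto simp: step_fun_def vectors_def)

lemma step_fun_uminus:
  assumes "X \<in> vectors"
  shows "step_fun (- X) r = - step_fun X r"
  using assms step_index_less[of r "dim_vec X"] by (auto simp: step_fun_def vectors_def)

lemma step_fun_zero: "0 < p \<Longrightarrow> step_fun (0\<^sub>v p) r = 0"
  using step_index_less[of r p] by (auto simp: step_fun_def)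

instantiation Omega_V :: (field) ab_group_add
begin

lift_definition zero_Omega_V :: "'a Omega_V" is "0\<^sub>v 1"
  by (simp add: vec_equiv_iff vectors_def)

lift_definition plus_Omega_V :: "'a Omega_V \<Rightarrow> 'a Omega_V \<Rightarrow> 'a Omega_V" is vec_boxplus
  by (auto simp: vec_equiv_iff boxplus_in_vectors step_fun_boxplus fun_eq_iff)

lift_definition uminus_Omega_V :: "'a Omega_V \<Rightarrow> 'a Omega_V" is "\<lambda>X. - X"
  by (auto simp: vec_equiv_iff step_fun_uminus fun_eq_iff) (auto simp: vectors_def)

definition minus_Omega_V :: "'a Omega_V \<Rightarrow> 'a Omega_V \<Rightarrow> 'a Omega_V" where
  "minus_Omega_V x y = x + - y"

instance
proof
  fix x y z :: "'a Omega_V"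
  have z: "(0\<^sub>v 1 :: 'a vec) \<in> vectors" by (simp add: vectors_def)
  have u: "- X \<in> vectors" if "X \<in> vectors" for X :: "'a vec"
    using that by (simp add: vectors_def)
  show "x + y + z = x + (y + z)"
    by transfer (auto simp: vec_equiv_iff boxplus_in_vectors step_fun_boxplus fun_eq_iff)
  show "x + y = y + x"
    by transfer (auto simp: vec_equiv_iff boxplus_in_vectors step_fun_boxplus fun_eq_iff)
  show "0 + x = x"
    by transfer (use z in \<open>auto simp: vec_equiv_iff boxplus_in_vectors step_fun_boxplus
        step_fun_zero fun_eq_iff simp del: One_nat_def\<close>)
  show "- x + x = 0"
    by transfer (use z u in \<open>auto simp: vec_equiv_iff boxplus_in_vectors step_fun_boxplus
        step_fun_uminus step_fun_zero fun_eq_iff simp del: One_nat_def\<close>)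
  show "x - y = x + - y" by (rule minus_Omega_V_def)
qed

end

lift_definition scale_Omega :: "'a::field \<Rightarrow> 'a Omega_V \<Rightarrow> 'a Omega_V" is "\<lambda>c X. c \<cdot>\<^sub>v X"
  by (auto simp: vec_equiv_iff step_fun_smult fun_eq_iff) (auto simp: vectors_def)

lemma vector_space_Omega: "vector_space (scale_Omega :: 'a::field \<Rightarrow> _)"
proof
  fix a b :: 'a and x y :: "'a Omega_V"
  have s: "c \<cdot>\<^sub>v X \<in> vectors" if "X \<in> vectors" for c and X :: "'a vec"
    using that by (simp add: vectors_def)
  show "scale_Omega a (x + y) = scale_Omega a x + scale_Omega a y"
    by transfer (auto simp: vec_equiv_iff boxplus_in_vectors step_fun_boxplus step_fun_smult s
        algebra_simps fun_eq_iff)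
  show "scale_Omega (a + b) x = scale_Omega a x + scale_Omega b x"
    by transfer (auto simp: vec_equiv_iff boxplus_in_vectors step_fun_boxplus step_fun_smult s
        algebra_simps fun_eq_iff)
  show "scale_Omega a (scale_Omega b x) = scale_Omega (a * b) x"
    by transfer (auto simp: vec_equiv_iff step_fun_smult s fun_eq_iff)
  show "scale_Omega 1 x = x"
    by transfer (auto simp: vec_equiv_iff step_fun_smult s fun_eq_iff)
qed

lemma vec_class_plus:
  assumes "X \<in> vectors" "Y \<in> vectors"
  shows "vec_class X + vec_class Y = vec_class (vec_boxplus X Y)"
  using assms by (intro plus_Omega_V.abs_eq) (simp_all add: vec_equiv_iff)

lemma scale_vec_class:
  assumes "X \<in> vectors"
  shows "scale_Omega a (vec_class X) = vec_class (a \<cdot>\<^sub>v X)"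
  using assms by (intro scale_Omega.abs_eq) (simp add: vec_equiv_iff)

end

theory Submission
  imports Defs
begin

text \<open>
  The identity \<open>(A \<otimes> I\<^sub>k)(X \<otimes> 1\<^sub>k) = (A X) \<otimes> 1\<^sub>k\<close> shows that, up to equivalence, \<open>vec_prod A X\<close> can be
  computed in any common dimension, not only in the least one. A dimension common to equivalent pairs
  \<open>A, X\<close> and \<open>B, Y\<close> makes the two products equal, and a dimension common to \<open>X\<close> and \<open>Y\<close>
  reduces additivity to that of the matrix-vector product.
\<close>

section \<open>Products computed in a common dimension\<close>

lemma kron_one_mult_kron_ones:
  fixes A :: "'a::field mat"
  assumes "dim_col A = dim_vec X" "0 < k"
  shows "(A \<otimes>\<^sub>m 1\<^sub>m k) *\<^sub>v (X \<otimes>\<^sub>v ones k) = (A *\<^sub>v X) \<otimes>\<^sub>v ones k"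
proof (rule eq_vecI)
  let ?n = "dim_vec X"
  fix i
  assume "i < dim_vec ((A *\<^sub>v X) \<otimes>\<^sub>v ones k)"
  then have i: "i < dim_row A * k" by simp
  then have ik: "i div k < dim_row A" by (simp add: less_mult_imp_div_less)
  \<comment> \<open>In the \<open>j\<close>-th block of length \<open>k\<close>, the only index with
    the same remainder as \<open>i\<close> is \<open>j * k + i mod k\<close>. The bound keeps it in
    range when the sum is reindexed by blocks.\<close>
  have blk: "j * k + i mod k < ?n * k" if "j < ?n" for j
  proof -
    have "j * k + i mod k < Suc j * k" using assms by simp
    also have "\<dots> \<le> ?n * k" using that by (intro mult_le_mono1) simp
    finally show ?thesis .
  qed
  \<comment> \<open>The identity factor is 1 when \<open>i\<close> and \<open>j\<close> have the
    same remainder modulo \<open>k\<close> and 0 otherwise, while the stretched vector is constant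
    on blocks.\<close>
  have "((A \<otimes>\<^sub>m 1\<^sub>m k) *\<^sub>v (X \<otimes>\<^sub>v ones k)) $ i =
      (\<Sum>j<?n * k. (if i mod k = j mod k then A $$ (i div k, j div k) * X $ (j div k) else 0))"
    using i assms
    by (auto simp: kron_def scalar_prod_def index_kron_ones atLeast0LessThan intro!: sum.cong)
  also have "\<dots> = (\<Sum>j\<in>{j \<in> {..<?n * k}. i mod k = j mod k}. A $$ (i div k, j div k) * X $ (j div k))"
    by (rule sum.inter_filter[symmetric]) simp
  also have "\<dots> = (\<Sum>j<?n. A $$ (i div k, j) * X $ j)"
    by (rule sum.reindex_bij_witness[where i = "\<lambda>j. j * k + i mod k" and j = "\<lambda>j. j div k"])
      (use assms blk in \<open>auto simp: less_mult_imp_div_less\<close>)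
  also have "\<dots> = ((A *\<^sub>v X) \<otimes>\<^sub>v ones k) $ i"
    using i ik assms by (simp add: index_kron_ones scalar_prod_def atLeast0LessThan)
  finally show "((A \<otimes>\<^sub>m 1\<^sub>m k) *\<^sub>v (X \<otimes>\<^sub>v ones k)) $ i = ((A *\<^sub>v X) \<otimes>\<^sub>v ones k) $ i" .
qed (simp add: kron_def)

lemma kron_ones_kron_ones:
  "(X \<otimes>\<^sub>v ones s) \<otimes>\<^sub>v ones u = X \<otimes>\<^sub>v ones (s * u)"
proof (rule eq_vecI)
  fix i
  assume "i < dim_vec (X \<otimes>\<^sub>v ones (s * u))"
  then have "i < dim_vec X * s * u" by (simp add: mult.assoc)
  moreover from this have "i div u < dim_vec X * s" by (rule less_mult_imp_div_less)
  moreover have "i div u div s = i div (s * u)" by (metis div_mult2_eq mult.commute)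
  ultimately show "((X \<otimes>\<^sub>v ones s) \<otimes>\<^sub>v ones u) $ i = (X \<otimes>\<^sub>v ones (s * u)) $ i"
    by (simp add: index_kron_ones mult.assoc)
qed (simp add: mult.assoc)

lemma lcm_div_pos:
  fixes m n :: nat
  assumes "0 < m" "0 < n"
  shows "0 < lcm m n div m" "0 < lcm m n div n"
  using assms by (simp_all add: div_greater_zero_iff dvd_imp_le lcm_pos_nat)

lemma vec_prod_in_vectors:
  assumes "A \<in> matrices" "X \<in> vectors"
  shows "vec_prod A X \<in> vectors"
  using assms lcm_div_pos(1)[of "dim_col A" "dim_vec X"]
  by (simp add: matrices_def vectors_def vec_prod_def Let_def kron_def)

text \<open>A common multiple of both dimensions is \<open>k\<close> times their lcm, so
  \<open>a\<close> and \<open>b\<close> are the multipliers from \<open>vec_prod\<close> times the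
  same \<open>k\<close>. The block identity then turns the product into \<open>vec_prod A X\<close>
  stretched by \<open>ones k\<close>, which leaves the step function unchanged.\<close>

lemma step_fun_vec_prod:
  assumes "A \<in> matrices" "X \<in> vectors" "0 < a" "dim_col A * a = dim_vec X * b"
  shows "step_fun ((A \<otimes>\<^sub>m 1\<^sub>m a) *\<^sub>v (X \<otimes>\<^sub>v ones b)) = step_fun (vec_prod A X)"
proof -
  let ?n = "dim_col A" and ?p = "dim_vec X"
  let ?t = "lcm ?n ?p"
  have np: "0 < ?n" "0 < ?p" using assms by (auto simp: matrices_def vectors_def)
  have "?t dvd ?n * a" by (metis assms(4) dvd_triv_left lcm_least)
  then obtain k where k: "?n * a = ?t * k" by (rule dvdE)
  have tn: "?n * (?t div ?n) = ?t" and tp: "?p * (?t div ?p) = ?t" by simp_all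
  have "?n * a = ?n * (?t div ?n * k)" "?p * b = ?p * (?t div ?p * k)"
    using k tn tp assms(4) by (metis mult.assoc)+
  then have ab: "a = ?t div ?n * k" "b = ?t div ?p * k"
    using np by (simp_all only: nat_mult_eq_cancel1)
  then have k0: "0 < k" using assms(3) by (metis mult_0_right neq0_conv)
  \<comment> \<open>The block identity is applied to the factors already stretched to dimension
    \<open>?t\<close>, not to \<open>A\<close> and \<open>X\<close> themselves.\<close>
  have "(A \<otimes>\<^sub>m 1\<^sub>m a) *\<^sub>v (X \<otimes>\<^sub>v ones b) = vec_prod A X \<otimes>\<^sub>v ones k"
    using kron_one_mult_kron_ones[of "A \<otimes>\<^sub>m 1\<^sub>m (?t div ?n)" "X \<otimes>\<^sub>v ones (?t div ?p)" k]
      kron_kron_one[of "?t div ?n" k A] kron_ones_kron_ones[of X "?t div ?p" k]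
      k0 lcm_div_pos[OF np] tn tp
    by (simp add: ab vec_prod_def Let_def kron_def[of A "1\<^sub>m (?t div ?n)"])
  then show ?thesis
    using step_fun_kron_ones[OF vec_prod_in_vectors[OF assms(1,2)] k0] by simp
qed

text \<open>The two witnessing equations live in dimensions \<open>N\<close> and \<open>P\<close>,
  which may differ. Stretching the matrix equation by \<open>P\<close> and the vector equation by
  \<open>N\<close> brings both to dimension \<open>N * P\<close>, where the two products are
  literally the same vector.\<close>

lemma vec_equiv_vec_prod:
  assumes "mat_equiv A B" "vec_equiv X Y"
  shows "vec_equiv (vec_prod A X) (vec_prod B Y)"
proof -
  from assms obtain s t u v where
    m: "A \<in> matrices" "B \<in> matrices" "X \<in> vectors" "Y \<in> vectors"
    and p: "0 < s" "0 < t" "0 < u" "0 < v"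
    and e: "A \<otimes>\<^sub>m 1\<^sub>m s = B \<otimes>\<^sub>m 1\<^sub>m t" "X \<otimes>\<^sub>v ones u = Y \<otimes>\<^sub>v ones v"
    unfolding mat_equiv_def vec_equiv_def by blast
  define N where "N = dim_col A * s"
  define P where "P = dim_vec X * u"
  \<comment> \<open>Measured from \<open>B\<close> and \<open>Y\<close> the dimensions are again
    \<open>N\<close> and \<open>P\<close>, so the second pair also meets the dimension condition of
    \<open>step_fun_vec_prod\<close>.\<close>
  have N: "N = dim_col B * t"
    using arg_cong[OF e(1), of dim_col] by (simp add: kron_def N_def)
  have P: "P = dim_vec Y * v"
    using arg_cong[OF e(2), of dim_vec] by (simp add: P_def)
  have pos: "0 < P" using m p by (simp add: vectors_def P_def)
  then have pos': "0 < N" using m p by (simp add: matrices_def N_def)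
  have "A \<otimes>\<^sub>m 1\<^sub>m (s * P) = B \<otimes>\<^sub>m 1\<^sub>m (t * P)"
    using arg_cong[OF e(1), of "\<lambda>M. M \<otimes>\<^sub>m 1\<^sub>m P"] p pos by (simp only: kron_kron_one)
  moreover have "X \<otimes>\<^sub>v ones (u * N) = Y \<otimes>\<^sub>v ones (v * N)"
    using arg_cong[OF e(2), of "\<lambda>Z. Z \<otimes>\<^sub>v ones N"] by (simp only: kron_ones_kron_ones)
  moreover have "step_fun ((A \<otimes>\<^sub>m 1\<^sub>m (s * P)) *\<^sub>v (X \<otimes>\<^sub>v ones (u * N))) = step_fun (vec_prod A X)"
    by (rule step_fun_vec_prod) (use m p pos in \<open>simp_all add: N_def P_def\<close>)
  moreover have "step_fun ((B \<otimes>\<^sub>m 1\<^sub>m (t * P)) *\<^sub>v (Y \<otimes>\<^sub>v ones (v * N))) = step_fun (vec_prod B Y)"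
    by (rule step_fun_vec_prod) (use m p pos in \<open>simp_all add: N P\<close>)
  ultimately show ?thesis
    using m by (simp add: vec_equiv_iff vec_prod_in_vectors)
qed

section \<open>Linearity in the vector argument\<close>

lemma kron_ones_add:
  "dim_vec X = dim_vec Y \<Longrightarrow> (X + Y) \<otimes>\<^sub>v ones s = X \<otimes>\<^sub>v ones s + Y \<otimes>\<^sub>v ones s"
  by (rule eq_vecI) (auto simp: index_kron_ones less_mult_imp_div_less)

lemma kron_ones_smult: "(c \<cdot>\<^sub>v X) \<otimes>\<^sub>v ones s = c \<cdot>\<^sub>v (X \<otimes>\<^sub>v ones s)"
  by (rule eq_vecI) (auto simp: index_kron_ones less_mult_imp_div_less)

lemma kron_one_carrier: "A \<otimes>\<^sub>m 1\<^sub>m s \<in> carrier_mat (dim_row A * s) (dim_col A * s)"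
  by (simp add: kron_def)

lemma kron_ones_carrier: "dim_vec X * s = n \<Longrightarrow> X \<otimes>\<^sub>v ones s \<in> carrier_vec n"
  by (rule carrier_vecI) simp

text \<open>Summands of equal dimension use the same lcm, hence the same multipliers, as their sum.
  Additivity is therefore an exact equality, inherited from distributivity of the matrix-vector
  product.\<close>

lemma vec_prod_add:
  assumes "dim_vec X = dim_vec Y"
  shows "vec_prod A (X + Y) = vec_prod A X + vec_prod A Y"
proof -
  let ?t = "lcm (dim_col A) (dim_vec Y)"
  \<comment> \<open>Both sides equal \<open>?t\<close>; the right-hand form is the column count that
    \<open>kron_one_carrier\<close> provides.\<close>
  have "dim_vec X * (?t div dim_vec Y) = dim_col A * (?t div dim_col A)"
    "dim_vec Y * (?t div dim_vec Y) = dim_col A * (?t div dim_col A)"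
    using assms by simp_all
  note mult_add_distrib_mat_vec[OF kron_one_carrier this[THEN kron_ones_carrier]]
  moreover have "dim_vec (X + Y) = dim_vec Y" by simp
  ultimately show ?thesis
    unfolding vec_prod_def Let_def by (simp only: assms kron_ones_add)
qed

lemma vec_prod_smult: "vec_prod A (c \<cdot>\<^sub>v X) = c \<cdot>\<^sub>v vec_prod A X"
proof -
  let ?t = "lcm (dim_col A) (dim_vec X)"
  have "dim_vec X * (?t div dim_vec X) = dim_col A * (?t div dim_col A)" by simp
  note mult_mat_vec[OF kron_one_carrier kron_ones_carrier[OF this]]
  then show ?thesis
    unfolding vec_prod_def Let_def by (simp only: index_smult_vec(2) kron_ones_smult)
qed

lemma vec_equiv_kron_ones: "X \<in> vectors \<Longrightarrow> 0 < s \<Longrightarrow> vec_equiv (X \<otimes>\<^sub>v ones s) X"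
  by (simp add: vec_equiv_iff kron_ones_in_vectors step_fun_kron_ones)

text \<open>Once \<open>X\<close> and \<open>Y\<close> are stretched to their common dimension,
  \<open>vec_boxplus\<close> is an ordinary sum and \<open>vec_prod_add\<close> applies. Stretching
  changes each product only up to equivalence, so the two sides are compared through step
  functions.\<close>

lemma vec_prod_boxplus:
  assumes "A \<in> matrices" "X \<in> vectors" "Y \<in> vectors"
  shows "vec_equiv (vec_prod A (vec_boxplus X Y)) (vec_boxplus (vec_prod A X) (vec_prod A Y))"
proof -
  let ?t = "lcm (dim_vec X) (dim_vec Y)"
  define X' where "X' = X \<otimes>\<^sub>v ones (?t div dim_vec X)"
  define Y' where "Y' = Y \<otimes>\<^sub>v ones (?t div dim_vec Y)"
  have eqv: "vec_equiv X' X" "vec_equiv Y' Y"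
    using assms lcm_div_pos[of "dim_vec X" "dim_vec Y"]
    by (simp_all add: X'_def Y'_def vec_equiv_kron_ones vectors_def)
  have d: "dim_vec X' = dim_vec Y'" by (simp add: X'_def Y'_def)
  \<comment> \<open>Reflexivity allows \<open>vec_equiv_vec_prod\<close> to be used with the matrix
    fixed and only the vector replaced.\<close>
  have A: "mat_equiv A A" using assms(1) by (auto simp: mat_equiv_def)
  have "step_fun (vec_prod A X') = step_fun (vec_prod A X)"
    "step_fun (vec_prod A Y') = step_fun (vec_prod A Y)" "vec_prod A X' \<in> vectors"
    using vec_equiv_vec_prod[OF A eqv(1)] vec_equiv_vec_prod[OF A eqv(2)]
    by (auto simp: vec_equiv_iff)
  moreover have "vec_prod A (vec_boxplus X Y) = vec_prod A X' + vec_prod A Y'"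
    using vec_prod_add[OF d] by (simp add: vec_boxplus_def Let_def X'_def Y'_def)
  moreover have "dim_vec (vec_prod A X') = dim_vec (vec_prod A Y')"
    using d by (simp add: vec_prod_def Let_def)
  ultimately have "step_fun (vec_prod A (vec_boxplus X Y)) =
      step_fun (vec_boxplus (vec_prod A X) (vec_prod A Y))"
    using assms by (simp add: vec_prod_in_vectors step_fun_boxplus step_fun_add fun_eq_iff)
  then show ?thesis
    using assms by (simp add: vec_equiv_iff vec_prod_in_vectors boxplus_in_vectors)
qed

section \<open>The induced map on classes\<close>

lift_definition class_prod :: "'a::field Sigma_M \<Rightarrow> 'a Omega_V \<Rightarrow> 'a Omega_V" is vec_prod
  by (rule vec_equiv_vec_prod)

lemma class_prod_classes:
  "A \<in> matrices \<Longrightarrow> X \<in> vectors \<Longrightarrow>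
    class_prod (mat_class A) (vec_class X) = vec_class (vec_prod A X)"
  by (rule class_prod.abs_eq) (auto simp: mat_equiv_def vec_equiv_iff)

text \<open>The induction rule of the partial quotient ranges only over \<open>A\<close> with
  \<open>mat_equiv A A\<close>, that is, over \<open>matrices\<close>, so the representative has
  positive dimensions.\<close>

lemma mat_class_cases:
  obtains A where "A \<in> matrices" "S = mat_class A"
  by (induction S rule: Sigma_M.abs_induct) (metis mat_equiv_def)

lemma vec_class_cases:
  obtains X where "X \<in> vectors" "x = vec_class X"
  by (induction x rule: Omega_V.abs_induct) (metis vec_equiv_iff)

lemma linear_class_prod:
  fixes S :: "'a::field Sigma_M"
  shows "Vector_Spaces.linear scale_Omega scale_Omega (class_prod S)"
proof -
  obtain A where A: "A \<in> matrices" "S = mat_class A" by (rule mat_class_cases)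
  show ?thesis
    unfolding Vector_Spaces.linear_iff
  \<comment> \<open>\<open>vector_space_Omega\<close> settles the conjuncts on domain and codomain;
    additivity and homogeneity remain.\<close>
  proof (intro conjI allI vector_space_Omega)
    fix x y :: "'a Omega_V"
    obtain X where X: "X \<in> vectors" "x = vec_class X" by (rule vec_class_cases)
    obtain Y where Y: "Y \<in> vectors" "y = vec_class Y" by (rule vec_class_cases)
    \<comment> \<open>On representatives, this equality of classes is the equivalence
      \<open>vec_prod_boxplus\<close>.\<close>
    show "class_prod S (x + y) = class_prod S x + class_prod S y"
      using vec_prod_boxplus[OF A(1) X(1) Y(1)] A X Y
      by (simp add: vec_class_plus class_prod_classes boxplus_in_vectors vec_prod_in_vectors
          vec_class_eq_iff)
    fix c and x :: "'a Omega_V"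
    obtain X where X: "X \<in> vectors" "x = vec_class X" by (rule vec_class_cases)
    moreover from X have "c \<cdot>\<^sub>v X \<in> vectors" by (simp add: vectors_def)
    ultimately show "class_prod S (scale_Omega c x) = scale_Omega c (class_prod S x)"
      using A by (simp add: scale_vec_class class_prod_classes vec_prod_in_vectors vec_prod_smult)
  qed
qed

text \<open>Every class has a representative, so the formula leaves no freedom. This gives
  uniqueness and also carries linearity from \<open>class_prod\<close> to any map satisfying the
  formula.\<close>

lemma class_prod_unique:
  fixes F :: "'a::field Sigma_M \<Rightarrow> 'a Omega_V \<Rightarrow> 'a Omega_V"
  assumes "\<forall>A \<in> matrices. \<forall>X \<in> vectors. F (mat_class A) (vec_class X) = vec_class (vec_prod A X)"
  shows "F = class_prod"
proof (intro ext)
  fix S :: "'a Sigma_M" and x :: "'a Omega_V"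
  obtain A where "A \<in> matrices" "S = mat_class A" by (rule mat_class_cases)
  moreover obtain X where "X \<in> vectors" "x = vec_class X" by (rule vec_class_cases)
  ultimately show "F S x = class_prod S x"
    using assms by (simp add: class_prod_classes)
qed

theorem corollary228:
  shows "(\<forall>(A :: 'a::field_char_0 mat) B X Y. mat_equiv A B \<longrightarrow> vec_equiv X Y \<longrightarrow>
            vec_equiv (vec_prod A X) (vec_prod B Y)) \<and>
         (\<exists>!F :: 'a Sigma_M \<Rightarrow> 'a Omega_V \<Rightarrow> 'a Omega_V.
            \<forall>A \<in> matrices. \<forall>X \<in> vectors.
              F (mat_class A) (vec_class X) = vec_class (vec_prod A X)) \<and>
         (\<forall>F :: 'a Sigma_M \<Rightarrow> 'a Omega_V \<Rightarrow> 'a Omega_V.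
            (\<forall>A \<in> matrices. \<forall>X \<in> vectors.
              F (mat_class A) (vec_class X) = vec_class (vec_prod A X)) \<longrightarrow>
            (\<forall>S. Vector_Spaces.linear scale_Omega scale_Omega (F S)))"
proof (intro conjI allI impI)
  fix A B :: "'a mat" and X Y :: "'a vec"
  assume "mat_equiv A B" "vec_equiv X Y"
  then show "vec_equiv (vec_prod A X) (vec_prod B Y)" by (rule vec_equiv_vec_prod)
next
  show "\<exists>!F :: 'a Sigma_M \<Rightarrow> 'a Omega_V \<Rightarrow> 'a Omega_V. \<forall>A \<in> matrices. \<forall>X \<in> vectors.
      F (mat_class A) (vec_class X) = vec_class (vec_prod A X)"
    by (rule ex1I[of _ class_prod]) (use class_prod_classes class_prod_unique in blast)+
next
  fix F :: "'a Sigma_M \<Rightarrow> 'a Omega_V \<Rightarrow> 'a Omega_V" and S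
  assume "\<forall>A \<in> matrices. \<forall>X \<in> vectors. F (mat_class A) (vec_class X) = vec_class (vec_prod A X)"
  then have "F = class_prod" by (rule class_prod_unique)
  then show "Vector_Spaces.linear scale_Omega scale_Omega (F S)"
    by (simp add: linear_class_prod)
qed

end
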